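(* For every integer $n>1$, the unitary Cayley graph $X_n$ is $(\Delta(X_n)+2)$-total colorable, where $\Delta(X_n)$ denotes the maximum degree of $X_n$.
   Context: All graphs are finite, simple and undirected. A total coloring of a graph $G$ is a map $f: V(G)\cup E(G)\to C$ ($C$ a set of colors) such that adjacent vertices receive different colors, edges sharing an endpoint receive different colors, and every edge receives a color different from those of its two endpoints. A graph is $q$-total colorable if it has a total coloring with $|C| = q$. For an integer $n>1$, the unitary Cayley graph $X_n=\mathrm{Cay}(\mathbb{Z}_n,U_n)$, with $U_n=\{a\in\mathbb{Z}_n:\gcd(a,n)=1\}$, has vertex set $\{0,1,\dots,n-1\}$, and $a,b$ are adjacent if and only if $\gcd(a-b,n)=1$. *)

theory Defs
  imports Complex_Main "HOL-Library.FuncSet"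
begin

text \<open>
  An undirected graph is a pair of a vertex set and an edge set, each edge being the
  two-element set of its endpoints.
\<close>

type_synonym 'a ugraph = "'a set \<times> 'a set set"

abbreviation verts :: "'a ugraph \<Rightarrow> 'a set" where
  "verts G \<equiv> fst G"

abbreviation edges :: "'a ugraph \<Rightarrow> 'a set set" where
  "edges G \<equiv> snd G"

definition finite_simple_graph :: "'a ugraph \<Rightarrow> bool" where
  "finite_simple_graph G \<longleftrightarrow>
     finite (verts G) \<and> (\<forall>e\<in>edges G. e \<subseteq> verts G \<and> card e = 2)"

definition adjacent :: "'a ugraph \<Rightarrow> 'a \<Rightarrow> 'a \<Rightarrow> bool" where
  "adjacent G u v \<longleftrightarrow> {u, v} \<in> edges G"

definition degree :: "'a ugraph \<Rightarrow> 'a \<Rightarrow> nat" where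
  "degree G v = card {e \<in> edges G. v \<in> e}"

text \<open>Only meaningful for graphs with at least one vertex.\<close>

definition max_degree :: "'a ugraph \<Rightarrow> nat" where
  "max_degree G = Max (degree G ` verts G)"

text \<open>
  The domain V(G) \<union> E(G) is the disjoint sum of vertices and edges: \<open>f (Inl v)\<close> is the color of
  the vertex \<open>v\<close> and \<open>f (Inr e)\<close> that of the edge \<open>e\<close>.
\<close>

definition total_coloring :: "'a ugraph \<Rightarrow> 'c set \<Rightarrow> ('a + 'a set \<Rightarrow> 'c) \<Rightarrow> bool" where
  "total_coloring G C f \<longleftrightarrow>
     f \<in> (verts G <+> edges G) \<rightarrow> C \<and>
     (\<forall>u\<in>verts G. \<forall>v\<in>verts G. adjacent G u v \<longrightarrow> f (Inl u) \<noteq> f (Inl v)) \<and>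
     (\<forall>e\<in>edges G. \<forall>e'\<in>edges G. e \<noteq> e' \<and> e \<inter> e' \<noteq> {} \<longrightarrow> f (Inr e) \<noteq> f (Inr e')) \<and>
     (\<forall>e\<in>edges G. \<forall>v\<in>e. f (Inr e) \<noteq> f (Inl v))"

text \<open>
  Colors are natural numbers, which is no restriction for finite color sets. Not every color
  has to be used.
\<close>

definition total_colorable :: "nat \<Rightarrow> 'a ugraph \<Rightarrow> bool" where
  "total_colorable q G \<longleftrightarrow>
     (\<exists>(C :: nat set) f. finite C \<and> card C = q \<and> total_coloring G C f)"

text \<open>
  The residues modulo \<open>n\<close> are represented by \<open>0, ..., n - 1\<close> in \<open>int\<close>, so that the difference
  of two vertices is not truncated.
\<close>

definition unitary_cayley_graph :: "int \<Rightarrow> int ugraph" where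
  "unitary_cayley_graph n =
     ({0..<n}, {{a, b} | a b. a \<in> {0..<n} \<and> b \<in> {0..<n} \<and> gcd (a - b) n = 1})"

lemma adjacent_unitary_cayley_graph:
  "adjacent (unitary_cayley_graph n) a b \<longleftrightarrow>
     a \<in> {0..<n} \<and> b \<in> {0..<n} \<and> gcd (a - b) n = 1"
proof -
  have "gcd (b - a) n = gcd (a - b) n"
    by (metis gcd_neg1_int minus_diff_eq)
  then show ?thesis
    unfolding adjacent_def unitary_cayley_graph_def snd_conv mem_Collect_eq doubleton_eq_iff
    by metis
qed

lemma finite_simple_graph_unitary_cayley_graph:
  assumes "n > 1"
  shows "finite_simple_graph (unitary_cayley_graph n)"
proof -
  have "card {a, b} = 2" if "gcd (a - b) n = 1" for a b
  proof -
    have "a \<noteq> b" using that assms by auto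
    then show ?thesis by simp
  qed
  then show ?thesis
    unfolding finite_simple_graph_def unitary_cayley_graph_def by auto
qed

end

theory Submission
  imports Defs
begin

text \<open>
  Let \<open>U\<close> be the set of units modulo \<open>n\<close>; the graph is \<open>card U\<close>-regular.

  If \<open>n\<close> is even, the parities of the vertices form a proper 2-coloring, and the edge from an even
  vertex \<open>a\<close> to an odd vertex \<open>b\<close> gets the color \<open>b - a \<in> U\<close>.

  If \<open>n\<close> is odd, let \<open>p\<close> be its least divisor greater than 1 and \<open>h = p div 2\<close>. Since \<open>p\<close> divides
  \<open>n\<close>, the standard total coloring \<open>a \<mapsto> 2 * a\<close>, \<open>{a, b} \<mapsto> a + b\<close> of the complete graph on
  \<open>\<int>/p\<close> lifts to a total coloring with \<open>p\<close> colors of all vertices and the edges with difference in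
  \<open>{\<plusminus>1, \<dots>, \<plusminus>h} \<subseteq> U\<close>. For each remaining pair \<open>\<plusminus>d\<close> of units the edges with difference \<open>\<plusminus>d\<close> form a
  Hamiltonian cycle of odd length. Walk through it from \<open>d/2\<close> to \<open>-d/2\<close> and color its edges
  alternately with \<open>d\<close> and \<open>-d\<close>. The edge closing the cycle is \<open>{d/2, -d/2}\<close>; for all \<open>d\<close> together
  these edges form a matching, which takes a single extra color. In total this uses
  \<open>p + (card U - (p - 1)) + 1 = card U + 2\<close> colors.
\<close>

section \<open>Total colorings from functions on ordered pairs\<close>

text \<open>Lets edges be colored by a function of their ordered endpoints, from any type of colors:
  symmetry makes the choice of order irrelevant, and colors embed into \<open>nat\<close>.\<close>

lemma total_colorableI:
  fixes G :: "'a ugraph" and C :: "'c set"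
  assumes G: "finite_simple_graph G"
    and C: "finite C" "card C \<le> q"
    and vC: "\<And>a. a \<in> verts G \<Longrightarrow> vc a \<in> C"
    and eC: "\<And>a b. adjacent G a b \<Longrightarrow> ec a b \<in> C"
    and sym: "\<And>a b. adjacent G a b \<Longrightarrow> ec b a = ec a b"
    and vv: "\<And>a b. adjacent G a b \<Longrightarrow> vc a \<noteq> vc b"
    and ev: "\<And>a b. adjacent G a b \<Longrightarrow> ec a b \<noteq> vc a"
    and ee: "\<And>a b c. adjacent G a b \<Longrightarrow> adjacent G a c \<Longrightarrow> b \<noteq> c \<Longrightarrow> ec a b \<noteq> ec a c"
  shows "total_colorable q G"
proof -
  define ends where "ends = (\<lambda>e :: 'a set. SOME (a, b). e = {a, b})"
  define g where "g = case_sum vc (\<lambda>e. case ends e of (a, b) \<Rightarrow> ec a b)"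
  have adj_sym: "adjacent G b a" if "adjacent G a b" for a b
    using that by (simp add: adjacent_def insert_commute)
  have gv: "g (Inl a) = vc a" for a
    by (simp add: g_def)
  have ge: "g (Inr {a, b}) = ec a b" if "adjacent G a b" for a b
  proof -
    obtain x y where xy: "ends {a, b} = (x, y)" by fastforce
    have "case ends {a, b} of (x, y) \<Rightarrow> {a, b} = {x, y}"
      unfolding ends_def by (rule someI[of _ "(a, b)"]) simp
    then have "x = a \<and> y = b \<or> x = b \<and> y = a"
      by (auto simp: xy doubleton_eq_iff)
    then show ?thesis
      using sym[OF that] by (auto simp: g_def xy)
  qed
  have edgeE: "\<exists>w. e = {v, w} \<and> adjacent G v w" if "e \<in> edges G" "v \<in> e" for e v
  proof -
    have "card e = 2" using G that by (auto simp: finite_simple_graph_def)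
    then obtain x y where "e = {x, y}" by (auto simp: card_2_iff)
    then show ?thesis using that by (auto simp: adjacent_def insert_commute)
  qed
  have ne: "e \<noteq> {}" if "e \<in> edges G" for e
    using G that by (auto simp: finite_simple_graph_def)
  have g: "total_coloring G C g"
    unfolding total_coloring_def
  proof (intro conjI ballI impI)
    show "g \<in> verts G <+> edges G \<rightarrow> C"
    proof
      fix z assume "z \<in> verts G <+> edges G"
      then show "g z \<in> C"
      proof
        fix a assume "a \<in> verts G" "z = Inl a"
        then show ?thesis by (simp add: gv vC)
      next
        fix e assume e: "e \<in> edges G" "z = Inr e"
        then obtain v where "v \<in> e" using ne by blast
        with e obtain w where "e = {v, w}" "adjacent G v w" using edgeE by blast
        then show ?thesis using e by (simp add: ge eC)
      qed
    qed
  next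
    fix u v assume "adjacent G u v"
    then show "g (Inl u) \<noteq> g (Inl v)" by (simp add: gv vv)
  next
    fix e e' assume e: "e \<in> edges G" "e' \<in> edges G" and "e \<noteq> e' \<and> e \<inter> e' \<noteq> {}"
    then obtain v where "v \<in> e" "v \<in> e'" by blast
    then obtain w w' where "e = {v, w}" "adjacent G v w" "e' = {v, w'}" "adjacent G v w'"
      using edgeE e by meson
    with \<open>e \<noteq> e' \<and> _\<close> show "g (Inr e) \<noteq> g (Inr e')"
      using ge ee[of v w w'] by auto
  next
    fix e v assume "e \<in> edges G" "v \<in> e"
    then obtain w where "e = {v, w}" "adjacent G v w" using edgeE by blast
    then show "g (Inr e) \<noteq> g (Inl v)" by (simp add: ge gv ev)
  qed
  obtain h :: "'c \<Rightarrow> nat" where h: "inj_on h C"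
    using finite_imp_inj_to_nat_seg[OF C(1)] by blast
  obtain E where E: "finite E" "card E = q - card C" "E \<subseteq> UNIV - h ` C"
    using infinite_arbitrarily_large[of "UNIV - h ` C" "q - card C"] C(1)
    by (auto simp: Diff_infinite_finite)
  define D where "D = h ` C \<union> E"
  have "card D = card (h ` C) + card E"
    unfolding D_def using C(1) E by (intro card_Un_disjoint) auto
  then have D: "finite D" "card D = q" "h ` C \<subseteq> D"
    using C E card_image[OF h] by (auto simp: D_def)
  have gC: "g z \<in> C" if "z \<in> verts G <+> edges G" for z
    using conjunct1[OF g[unfolded total_coloring_def]] that by (rule Pi_mem)
  have "h (g z) \<noteq> h (g z')"
    if "g z \<noteq> g z'" "z \<in> verts G <+> edges G" "z' \<in> verts G <+> edges G" for z z'
    using that h gC by (simp add: inj_on_eq_iff)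
  moreover have "v \<in> verts G" if "e \<in> edges G" "v \<in> e" for e v
    using that G unfolding finite_simple_graph_def by blast
  moreover have "h \<circ> g \<in> verts G <+> edges G \<rightarrow> D"
    using gC D(3) by (simp add: Pi_iff image_subset_iff)
  ultimately have "total_coloring G D (h \<circ> g)"
    using g unfolding total_coloring_def o_def by (simp add: InlI InrI)
  then show ?thesis
    using D unfolding total_colorable_def by blast
qed

section \<open>Units and the maximum degree\<close>

definition int_units :: "int \<Rightarrow> int set" where
  "int_units n = {d \<in> {0..<n}. coprime d n}"

lemma finite_int_units [simp]: "finite (int_units n)"
  by (rule finite_subset[of _ "{0..<n}"]) (auto simp: int_units_def)

lemma zero_notin_int_units: "n > 1 \<Longrightarrow> 0 \<notin> int_units n"
  by (simp add: int_units_def)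

lemma mod_in_int_units_iff: "n > 1 \<Longrightarrow> d mod n \<in> int_units n \<longleftrightarrow> coprime d n"
  by (simp add: int_units_def)

lemma adjacent_iff:
  "adjacent (unitary_cayley_graph n) a b \<longleftrightarrow> a \<in> {0..<n} \<and> b \<in> {0..<n} \<and> coprime (b - a) n"
  using coprime_minus_left_iff[of "b - a" n]
  by (auto simp: adjacent_unitary_cayley_graph coprime_iff_gcd_eq_1)

lemma card_int_units_le_max_degree:
  assumes "n > 1"
  shows "card (int_units n) \<le> max_degree (unitary_cayley_graph n)"
proof -
  let ?G = "unitary_cayley_graph n"
  have fin: "finite (edges ?G)"
    by (rule finite_subset[of _ "Pow {0..<n}"]) (auto simp: unitary_cayley_graph_def)
  have "inj_on (\<lambda>d. {0, d}) (int_units n)"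
    by (auto simp: inj_on_def doubleton_eq_iff)
  then have "card (int_units n) = card ((\<lambda>d. {0, d}) ` int_units n)"
    by (simp add: card_image)
  also have "\<dots> \<le> degree ?G 0"
    unfolding degree_def
  proof (rule card_mono)
    have "adjacent ?G 0 d" if "d \<in> int_units n" for d
      using that assms by (simp add: adjacent_iff int_units_def)
    then show "(\<lambda>d. {0, d}) ` int_units n \<subseteq> {e \<in> edges ?G. 0 \<in> e}"
      by (auto simp: adjacent_def)
  qed (use fin in simp)
  also have "\<dots> \<le> max_degree ?G"
    unfolding max_degree_def using assms
    by (intro Max_ge) (auto simp: unitary_cayley_graph_def)
  finally show ?thesis .
qed

lemma eq_of_mod_diff_eq:
  fixes a b c n :: int
  assumes "b \<in> {0..<n}" "c \<in> {0..<n}" "(b - a) mod n = (c - a) mod n"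
  shows "b = c"
proof -
  have "b mod n = c mod n"
    using assms(3) by (metis diff_add_cancel mod_add_left_eq)
  then show ?thesis using assms by simp
qed

lemma mod_diff_swap:
  fixes a b n :: int
  assumes "n > 0" "(b - a) mod n \<noteq> 0"
  shows "(a - b) mod n = n - (b - a) mod n"
  using assms zmod_zminus1_eq_if[of "b - a" n] by simp

section \<open>Even modulus\<close>

lemma total_colorable_even:
  fixes n :: int
  assumes n: "n > 1" "even n" and q: "card (int_units n) + 2 \<le> q"
  shows "total_colorable q (unitary_cayley_graph n)"
proof -
  let ?G = "unitary_cayley_graph n"
  define ec :: "int \<Rightarrow> int \<Rightarrow> bool + int" where
    "ec = (\<lambda>a b. Inr ((if even a then b - a else a - b) mod n))"
  have par: "even a \<longleftrightarrow> odd b" if "adjacent ?G a b" for a b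
  proof -
    have "coprime (b - a) n" using that by (simp add: adjacent_iff)
    then have "\<not> 2 dvd b - a"
      using n(2) by (metis coprime_common_divisor_int abs_numeral numeral_eq_one_iff semiring_norm(85))
    then show ?thesis by auto
  qed
  show ?thesis
  proof (rule total_colorableI[where C = "UNIV <+> int_units n" and vc = "Inl \<circ> even" and ec = ec])
    show "finite_simple_graph ?G"
      using n(1) by (rule finite_simple_graph_unitary_cayley_graph)
  next
    fix a b assume ab: "adjacent ?G a b"
    show "ec a b \<in> UNIV <+> int_units n"
      using ab n coprime_minus_left_iff[of "b - a" n]
      by (auto simp: ec_def adjacent_iff mod_in_int_units_iff)
    show "ec b a = ec a b" "(Inl \<circ> even) a \<noteq> (Inl \<circ> even) b"
      using par[OF ab] by (auto simp: ec_def)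
  next
    fix a b c assume abc: "adjacent ?G a b" "adjacent ?G a c" "b \<noteq> c"
    \<comment> \<open>For odd \<open>a\<close> the edge colors are differences taken towards
      \<open>a\<close>; negation reduces this to the even case.\<close>
    have "(a - b) mod n \<noteq> (a - c) mod n"
      using abc eq_of_mod_diff_eq[of b n c a] by (metis adjacent_iff minus_diff_eq mod_minus_cong)
    then show "ec a b \<noteq> ec a c"
      using abc eq_of_mod_diff_eq[of b n c a] by (auto simp: ec_def adjacent_iff)
  qed (use q in \<open>auto simp: card_Plus ec_def\<close>)
qed

section \<open>Hamiltonian cycles for odd modulus\<close>

text \<open>
  The position of \<open>a\<close> on the cycle \<open>d/2, d/2 + d, d/2 + 2 * d, \<dots>\<close> modulo \<open>n\<close>; multiplying by 2
  avoids the division.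
\<close>

definition cycle_pos :: "int \<Rightarrow> int \<Rightarrow> int \<Rightarrow> int" where
  "cycle_pos n d a = (THE k. k \<in> {0..<n} \<and> n dvd (2 * k + 1) * d - 2 * a)"

text \<open>As \<open>2 * d\<close> is invertible modulo \<open>n\<close>, subtracting the two
  conditions leaves \<open>n dvd k - k'\<close>.\<close>

lemma cycle_pos_unique:
  fixes n d a k k' :: int
  assumes "odd n" "coprime d n" "k \<in> {0..<n}" "k' \<in> {0..<n}"
    and "n dvd (2 * k + 1) * d - 2 * a" "n dvd (2 * k' + 1) * d - 2 * a"
  shows "k = k'"
proof -
  have "n dvd ((2 * k + 1) * d - 2 * a) - ((2 * k' + 1) * d - 2 * a)"
    using assms(5,6) by (rule dvd_diff)
  then have "n dvd (k - k') * (2 * d)" by (simp add: algebra_simps)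
  moreover have "coprime n (2 * d)"
    using assms by (simp add: coprime_commute)
  ultimately have "n dvd k - k'"
    by (simp add: coprime_dvd_mult_left_iff)
  then show ?thesis
    using assms by (metis atLeastLessThan_iff mod_eq_dvd_iff mod_pos_pos_trivial)
qed

lemma cycle_pos_eqI:
  assumes "odd n" "coprime d n" "k \<in> {0..<n}" "n dvd (2 * k + 1) * d - 2 * a"
  shows "cycle_pos n d a = k"
  unfolding cycle_pos_def
  by (rule the_equality) (use assms cycle_pos_unique[OF assms(1,2)] in blast)+

lemma cycle_pos:
  assumes n: "n > 0" "odd n" and "coprime d n"
  shows "cycle_pos n d a \<in> {0..<n}" "n dvd (2 * cycle_pos n d a + 1) * d - 2 * a"
proof -
  obtain u v where uv: "u * d + v * n = 1"
    using bezout_int[of d n] assms(3) by (auto simp: coprime_iff_gcd_eq_1)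
  obtain m where m: "n = 2 * m + 1" using n(2) by (elim oddE)
  \<comment> \<open>With \<open>u\<close> inverse to \<open>d\<close>, one must solve 2k + 1 = 2au
    modulo \<open>n\<close>; since n = 2m + 1, \<open>m\<close> represents -1/2.\<close>
  define k where "k = (a * u + m) mod n"
  define q where "q = (a * u + m) div n"
  have k: "k = a * u + m - n * q"
    by (simp add: k_def q_def minus_mult_div_eq_mod)
  have "(2 * k + 1) * d - 2 * a = 2 * a * (u * d) + n * d - 2 * n * q * d - 2 * a"
    unfolding k by (simp add: m algebra_simps)
  also have "u * d = 1 - v * n" using uv by simp
  also have "2 * a * (1 - v * n) + n * d - 2 * n * q * d - 2 * a = n * (d - 2 * q * d - 2 * a * v)"
    by (simp add: algebra_simps)
  finally have "n dvd (2 * k + 1) * d - 2 * a" by simp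
  moreover have "k \<in> {0..<n}" using n by (simp add: k_def)
  ultimately show "cycle_pos n d a \<in> {0..<n}" "n dvd (2 * cycle_pos n d a + 1) * d - 2 * a"
    using cycle_pos_eqI[OF n(2) assms(3)] by auto
qed

text \<open>The cycle of -d starts at -d/2, the last vertex of the cycle of \<open>d\<close>, and
  runs through it backwards. Here \<open>n - d\<close> stands for -d.\<close>

lemma cycle_pos_backwards:
  assumes "n > 0" "odd n" "coprime d n"
  shows "cycle_pos n (n - d) a = n - 1 - cycle_pos n d a"
proof (rule cycle_pos_eqI)
  let ?k = "cycle_pos n d a"
  obtain q where "(2 * ?k + 1) * d - 2 * a = n * q"
    using cycle_pos(2)[OF assms, of a] by (elim dvdE)
  then have "(2 * (n - 1 - ?k) + 1) * (n - d) - 2 * a = n * (2 * n - 2 * ?k - 1 - 2 * d + q)"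
    by (simp add: algebra_simps)
  then show "n dvd (2 * (n - 1 - ?k) + 1) * (n - d) - 2 * a" by simp
  show "coprime (n - d) n"
    using assms(3) by (simp add: coprime_iff_gcd_eq_1 gcd_diff2)
qed (use assms cycle_pos(1)[OF assms, of a] in auto)

text \<open>\<open>b\<close> follows \<open>a\<close> on the cycle of \<open>d\<close>, so its
  position there is one larger; reversal then gives n - 1 - (k + 1).\<close>

lemma cycle_pos_reverse_edge:
  assumes "n > 0" "odd n" "coprime d n"
    and b: "n dvd b - a - d" and "\<not> n dvd a + b"
  shows "cycle_pos n (n - d) b = n - 2 - cycle_pos n d a"
proof (rule cycle_pos_eqI)
  let ?k = "cycle_pos n d a"
  obtain q where q: "(2 * ?k + 1) * d - 2 * a = n * q"
    using cycle_pos(2)[OF assms(1-3), of a] by (elim dvdE)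
  obtain r where r: "b = a + d + n * r"
    using b by (metis add.commute diff_add_cancel diff_diff_eq dvdE)
  have "(2 * (n - 2 - ?k) + 1) * (n - d) - 2 * b = n * (2 * n - 2 * ?k - 3 - 2 * d + q - 2 * r)"
    using q by (simp add: r algebra_simps)
  then show "n dvd (2 * (n - 2 - ?k) + 1) * (n - d) - 2 * b" by simp
  show "coprime (n - d) n"
    using assms(3) by (simp add: coprime_iff_gcd_eq_1 gcd_diff2)
  \<comment> \<open>At the last position \<open>a\<close> is -d/2 and \<open>b\<close> is d/2 modulo
    \<open>n\<close>: this is the excluded closing edge.\<close>
  have "?k \<noteq> n - 1"
  proof
    assume "?k = n - 1"
    then have k: "?k = n - 1" .
    have "a + b = n * (2 * d - q + r)"
      using q unfolding k by (simp add: r algebra_simps)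
    then show False using assms(5) by simp
  qed
  then show "n - 2 - ?k \<in> {0..<n}"
    using cycle_pos(1)[OF assms(1-3), of a] by auto
qed (fact assms)

section \<open>Alternating colors on the cycles\<close>

text \<open>The color 0 is given to the edges that close the cycles.\<close>

definition cycle_color :: "int \<Rightarrow> int \<Rightarrow> int \<Rightarrow> int" where
  "cycle_color n a b =
     (let d = (b - a) mod n
      in if n dvd a + b then 0 else if even (cycle_pos n d a) then d else n - d)"

lemma cycle_color_range:
  "cycle_color n a b \<in> {0, (b - a) mod n, n - (b - a) mod n}"
  by (simp add: cycle_color_def Let_def)

text \<open>Reversing the edge swaps \<open>d\<close> with \<open>n - d\<close> and turns position k
  into n - 2 - k, of opposite parity as \<open>n\<close> is odd. The two changes cancel.\<close>

lemma cycle_color_commute: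
  assumes "n > 1" "odd n" "coprime (b - a) n"
  shows "cycle_color n b a = cycle_color n a b"
proof (cases "n dvd a + b")
  case True
  then show ?thesis by (simp add: cycle_color_def add.commute)
next
  case False
  let ?d = "(b - a) mod n"
  have d: "coprime ?d n" using assms by simp
  then have "?d \<noteq> 0" using assms(1) by auto
  then have swap: "(a - b) mod n = n - ?d"
    using assms by (intro mod_diff_swap) auto
  have "n dvd b - a - ?d" by simp
  then have "cycle_pos n (n - ?d) b = n - 2 - cycle_pos n ?d a"
    using assms d False by (intro cycle_pos_reverse_edge) auto
  then show ?thesis
    using False assms(2) by (simp add: cycle_color_def Let_def swap add.commute)
qed

text \<open>Color 0 leads from \<open>a\<close> only to -a. Any other common color forces opposite
  differences, so both edges lie on one cycle; the positions k and n - 1 - k of \<open>a\<close>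
  have equal parity, which selects \<open>d\<close> for one edge and \<open>n - d\<close> for the
  other.\<close>

lemma cycle_color_neq:
  assumes n: "n > 1" "odd n" and bc: "b \<in> {0..<n}" "c \<in> {0..<n}" "b \<noteq> c"
    and "coprime (b - a) n" "coprime (c - a) n"
  shows "cycle_color n a b \<noteq> cycle_color n a c"
proof
  assume eq: "cycle_color n a b = cycle_color n a c"
  let ?d = "(b - a) mod n" and ?e = "(c - a) mod n"
  have d: "coprime ?d n" and e: "coprime ?e n" using assms by simp_all
  then have "?d \<noteq> 0" "?e \<noteq> 0"
    using n by auto+
  moreover have "?d < n" "?e < n" using n by simp_all
  ultimately have zero: "cycle_color n a x = 0 \<longleftrightarrow> n dvd a + x" if "x = b \<or> x = c" for x
    using that by (auto simp: cycle_color_def Let_def)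
  show False
  proof (cases "n dvd a + b")
    case True
    then have "n dvd a + c" using zero eq by metis
    with True have "n dvd (a + b) - (a + c)" by (rule dvd_diff)
    then have "n dvd b - c" by simp
    then show False
      using bc by (metis atLeastLessThan_iff mod_eq_dvd_iff mod_pos_pos_trivial)
  next
    case False
    then have *: "\<not> n dvd a + c" using zero eq by metis
    have "?d \<noteq> ?e" using bc eq_of_mod_diff_eq by blast
    with False * have e_eq: "?e = n - ?d"
      using eq by (auto simp: cycle_color_def Let_def split: if_splits)
    have "cycle_pos n ?e a = n - 1 - cycle_pos n ?d a"
      unfolding e_eq using n d by (intro cycle_pos_backwards) auto
    then have "even (cycle_pos n ?e a) \<longleftrightarrow> even (cycle_pos n ?d a)"
      using n(2) by simp
    with False * \<open>?d \<noteq> ?e\<close> show False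
      using eq by (auto simp: cycle_color_def Let_def e_eq split: if_splits)
  qed
qed

section \<open>Odd modulus\<close>

lemma total_colorable_odd:
  fixes n :: int
  assumes n: "n > 1" "odd n" and q: "card (int_units n) + 2 \<le> q"
  shows "total_colorable q (unitary_cayley_graph n)"
proof -
  let ?G = "unitary_cayley_graph n" and ?U = "int_units n"
  define P where "P = (\<lambda>m. m > 1 \<and> int m dvd n)"
  define p where "p = int (Least P)"
  have "P (nat n)" using n by (simp add: P_def)
  then have "P (Least P)" by (rule LeastI)
  then have p: "p > 1" "p dvd n" by (simp_all add: p_def P_def)
  have p_least: "p \<le> m" if "m > 1" "m dvd n" for m
    using that Least_le[of P "nat m"] by (simp add: p_def P_def)
  have "odd p" using p(2) n(2) dvd_trans by blast
  then obtain h where h: "p = 2 * h + 1" by (elim oddE)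
  have "p \<le> n" using p n by (simp add: zdvd_imp_le)
  define N where "N = {1..h} \<union> {n - h..<n}"
  have finN: "finite N" by (simp add: N_def)
  \<comment> \<open>Otherwise \<open>gcd x n\<close> would be a divisor of \<open>n\<close> greater
    than 1 and below \<open>p\<close>.\<close>
  have cop: "coprime x n" if "0 < x" "x < p" for x
  proof -
    have "gcd x n \<le> x" using that by (simp add: zdvd_imp_le)
    then have "\<not> p \<le> gcd x n" using that by linarith
    then have "\<not> gcd x n > 1" using p_least by blast
    moreover have "gcd x n > 0" using that by simp
    ultimately have "gcd x n = 1" by linarith
    then show ?thesis by (simp add: coprime_iff_gcd_eq_1)
  qed
  have NU: "N \<subseteq> ?U"
  proof
    fix x assume x: "x \<in> N"
    have "coprime x n"
    proof (cases "x \<le> h")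
      case True
      then show ?thesis using x cop[of x] h \<open>p \<le> n\<close> by (auto simp: N_def)
    next
      case False
      then have "coprime (n - x) n" using x cop[of "n - x"] h by (auto simp: N_def)
      then show ?thesis by (simp add: coprime_iff_gcd_eq_1 gcd_diff2)
    qed
    then show "x \<in> ?U" using x h \<open>p \<le> n\<close> p by (auto simp: N_def int_units_def)
  qed
  have "card N = nat h + nat h"
    unfolding N_def using h \<open>p \<le> n\<close> by (subst card_Un_disjoint) auto
  then have cardN: "nat p = card N + 1" using h p by simp
  \<comment> \<open>Closure under negation makes the case split in \<open>ec\<close> symmetric and
    keeps cycle colors outside \<open>N\<close>.\<close>
  have N_uminus: "n - d \<in> N \<longleftrightarrow> d \<in> N" if "d \<in> ?U" for d
    using that h \<open>p \<le> n\<close> by (auto simp: N_def int_units_def)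
  \<comment> \<open>For elements of opposite blocks, shifting the difference by the multiple
    \<open>n\<close> of \<open>p\<close> yields a sum of two elements of \<open>{1..h}\<close>,
    strictly between 0 and \<open>p\<close>.\<close>
  have N_mod_p: "d = e" if "d \<in> N" "e \<in> N" "p dvd d - e" for d e
  proof -
    have "\<bar>d - e\<bar> < p \<or> d \<in> {1..h} \<and> n - e \<in> {1..h} \<or> e \<in> {1..h} \<and> n - d \<in> {1..h}"
      using that(1,2) unfolding h N_def Un_iff atLeastAtMost_iff atLeastLessThan_iff by arith
    then consider "\<bar>d - e\<bar> < p" | "d \<in> {1..h}" "n - e \<in> {1..h}" | "e \<in> {1..h}" "n - d \<in> {1..h}"
      by blast
    then show ?thesis
    proof cases
      case 1
      then show ?thesis using dvd_imp_le_int[of "d - e" p] that(3) by linarith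
    next
      case 2
      have "p dvd (d - e) + n" using that(3) p(2) by (rule dvd_add)
      then show ?thesis using 2 h zdvd_imp_le[of p "d - e + n"] by auto
    next
      case 3
      have "p dvd n - (d - e)" using p(2) that(3) by (rule dvd_diff)
      then show ?thesis using 3 h zdvd_imp_le[of p "n - (d - e)"] by auto
    qed
  qed
  have p_diff: "\<not> p dvd b - a" if "coprime (b - a) n" for a b
    using that p coprime_common_divisor_int[of "b - a" n p] by auto
  define C :: "(int + int) set" where "C = {0..<p} <+> insert 0 (?U - N)"
  define vc :: "int \<Rightarrow> int + int" where "vc = (\<lambda>a. Inl ((a + a) mod p))"
  define ec :: "int \<Rightarrow> int \<Rightarrow> int + int" where
    "ec = (\<lambda>a b. if (b - a) mod n \<in> N then Inl ((a + b) mod p) else Inr (cycle_color n a b))"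
  show ?thesis
  proof (rule total_colorableI[where C = C and vc = vc and ec = ec])
    show "finite_simple_graph ?G"
      using n(1) by (rule finite_simple_graph_unitary_cayley_graph)
    show "finite C" by (simp add: C_def)
    have "card C = nat p + (1 + (card ?U - card N))"
      using n(1) NU finN by (simp add: C_def card_Plus zero_notin_int_units card_Diff_subset)
    also have "\<dots> = card ?U + 2"
      using cardN card_mono[OF finite_int_units NU] by simp
    finally show "card C \<le> q" using q by simp
    show "vc a \<in> C" for a using p by (auto simp: C_def vc_def)
  next
    fix a b assume "adjacent ?G a b"
    then have ab: "coprime (b - a) n" by (simp add: adjacent_iff)
    let ?d = "(b - a) mod n"
    have d: "?d \<in> ?U" using n ab by (simp add: mod_in_int_units_iff)
    then have "?d \<noteq> 0" using zero_notin_int_units n(1) by metis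
    then have swap: "(a - b) mod n = n - ?d" using n by (intro mod_diff_swap) auto
    have "n - ?d \<in> ?U"
      using n ab coprime_minus_left_iff[of "b - a" n]
      unfolding swap[symmetric] by (simp add: mod_in_int_units_iff)
    then show "ec a b \<in> C"
      using p d N_uminus[OF d] cycle_color_range[of n a b] by (auto simp: ec_def C_def)
    show "ec b a = ec a b"
      using n ab N_uminus[OF d] by (simp add: ec_def swap cycle_color_commute add.commute)
    \<comment> \<open>Equality would mean a + b = 2a modulo \<open>p\<close>, hence
      \<open>p dvd b - a\<close>.\<close>
    show "ec a b \<noteq> vc a"
      using p_diff[OF ab] by (auto simp: ec_def vc_def mod_eq_dvd_iff)
    have "coprime p 2" using \<open>odd p\<close> by simp
    moreover have "\<not> p dvd a - b"
      using p_diff[OF ab] by (simp add: dvd_diff_commute)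
    ultimately have "\<not> p dvd 2 * (a - b)"
      by (simp only: coprime_dvd_mult_right_iff simp_thms)
    then show "vc a \<noteq> vc b"
      by (simp add: vc_def mod_eq_dvd_iff algebra_simps)
  next
    fix a b c assume "adjacent ?G a b" "adjacent ?G a c" and "b \<noteq> c"
    then have bc: "b \<in> {0..<n}" "c \<in> {0..<n}" and cop: "coprime (b - a) n" "coprime (c - a) n"
      by (simp_all add: adjacent_iff)
    have "(b - a) mod n \<noteq> (c - a) mod n"
      using bc \<open>b \<noteq> c\<close> eq_of_mod_diff_eq by blast
    moreover have "p dvd (b - a) mod n - (c - a) mod n" if "(a + b) mod p = (a + c) mod p"
    proof -
      \<comment> \<open>Reduction modulo \<open>n\<close> preserves residues modulo \<open>p\<close>
        because \<open>p dvd n\<close>.\<close>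
      have "((b - a) mod n) mod p = ((c - a) mod n) mod p"
        using that p(2) by (simp add: mod_mod_cancel mod_eq_dvd_iff)
      then show ?thesis by (simp add: mod_eq_dvd_iff)
    qed
    ultimately have "(a + b) mod p \<noteq> (a + c) mod p"
      if "(b - a) mod n \<in> N" "(c - a) mod n \<in> N"
      using that N_mod_p by blast
    then show "ec a b \<noteq> ec a c"
      using cycle_color_neq[OF n bc \<open>b \<noteq> c\<close> cop] by (auto simp: ec_def)
  qed
qed

theorem theorem2p5:
  fixes n :: int
  assumes "n > 1"
  shows "total_colorable (max_degree (unitary_cayley_graph n) + 2) (unitary_cayley_graph n)"
  using assms card_int_units_le_max_degree[OF assms]
  by (cases "even n") (auto intro: total_colorable_even total_colorable_odd)

end
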